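(* Suppose that after time slot $n_1$, $M'$ of the $M$ UEs in the cell ($M'<M$), say UEs $1,\dots,M'$, change their application usage percentages, so that their aggregated utility functions change from $V_i$ to $V_i'$, while UEs $M'+1,\dots,M$ keep $V_i$. Suppose all $M$ UEs rebid for resources and the distributed resource allocation algorithm reaches a steady state at $n_1$ (before the change) and again at $n_2>n_1$ (after the change). Then the allocated rates and bids remain optimal: the steady state rates $r_i(n_1)$ and bids $w_i(n_1)$ are optimal for the aggregated utilities before the change, and the steady state rates $r_i(n_2)$ and bids $w_i(n_2)$, $i=1,\dots,M$, are optimal for the aggregated utilities after the change.
   Context: A base station (eNB) with total rate $R>0$ serves $M$ user equipments (UEs). UE $i$ has a subscription weight $\beta_i>0$ and an aggregated utility function $W_i:[0,\infty)\to[0,\infty)$ of its total rate $r_i$ ($W_i=V_i$ or $W_i=V_i'$ depending on the UE and the time), obtained from the utilities $U_{ij}$ and usage percentages $\alpha_{ij}>0$, $\sum_j\alpha_{ij}=1$, of its applications as $W_i(r_i)=\prod_j U_{ij}(r_{ij})^{\alpha_{ij}}$ with $r_i=\sum_j r_{ij}$, the rate $r_i$ being split optimally among the applications. Standing facts: $W_i>0$ on $(0,\infty)$, $W_i(0)=0$, and $\log W_i$ is differentiable and strictly concave on $(0,\infty)$. The slope curvature function of UE $i$ is $\beta_i\frac{d}{dr}\log W_i(r)$, $r>0$; it is strictly decreasing. It is denoted $S_i$ when $W_i=V_i$ and $S_i'$ when $W_i=V_i'$; inverses are taken on the range. Optimality: the rates $(r_1,\dots,r_M)$ are optimal for aggregated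 utilities $(W_i)$ if they maximize $\prod_{i=1}^M W_i(r_i)^{\beta_i}$ subject to $\sum_{i=1}^M r_i\le R$ and $r_i\ge 0$. Bids $(w_1,\dots,w_M)$ are optimal if $w_i=p^*r_i^*$, where $(r_i^* )$ are the optimal rates and $p^*$ is the Lagrange multiplier of the constraint $\sum_i r_i\le R$ for the problem of maximizing $\sum_i\beta_i\log W_i(r_i)$ (the optimal shadow price). Distributed algorithm: each bidding UE receives the current shadow price $p>0$ from the eNB, computes as its rate the inverse of its current slope curvature function at $p$, and bids $p$ times this rate; the eNB updates the shadow price as the sum of the bids divided by $R$. A steady state at time $n$ with all UEs (re)bidding means: $p(n)>0$, $p(n)=\frac1R\sum_{i=1}^{M}w_i(n)$, $w_i(n)=p(n)r_i(n)$ for all $i$, and $r_i(n)$ is the value at $p(n)$ of the inverse of the current slope curvature function of UE $i$: $r_i(n_1)=S_i^{-1}(p(n_1))$ for all $i$; $r_i(n_2)=S_i'^{-1}(p(n_2))$ for $i\le M'$ and $r_i(n_2)=S_i^{-1}(p(n_2))$ for $i>M'$. *)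

theory Defs
  imports "HOL-Analysis.Analysis"
begin

text \<open>Rates, bids and utilities of UEs are families indexed by \<open>{1..M}\<close>; the applications of
  UE \<open>i\<close> are indexed by \<open>{1..N i}\<close>. Utilities are functions of a real rate of which only the
  values on \<open>[0,\<infinity>)\<close> matter.\<close>

definition usage_percentages :: "nat \<Rightarrow> (nat \<Rightarrow> real) \<Rightarrow> bool" where
  "usage_percentages N \<alpha> \<longleftrightarrow> (\<forall>j\<in>{1..N}. 0 < \<alpha> j) \<and> (\<Sum>j=1..N. \<alpha> j) = 1"

definition rate_split :: "nat \<Rightarrow> real \<Rightarrow> (nat \<Rightarrow> real) \<Rightarrow> bool" where
  "rate_split N \<rho> s \<longleftrightarrow> (\<forall>j\<in>{1..N}. 0 \<le> s j) \<and> (\<Sum>j=1..N. s j) = \<rho>"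

definition aggregated_utility ::
  "nat \<Rightarrow> (nat \<Rightarrow> real \<Rightarrow> real) \<Rightarrow> (nat \<Rightarrow> real) \<Rightarrow> (real \<Rightarrow> real) \<Rightarrow> bool" where
  "aggregated_utility N U \<alpha> W \<longleftrightarrow>
     (\<forall>\<rho>\<ge>0. \<exists>s. is_arg_max (\<lambda>s. \<Prod>j=1..N. U j (s j) powr \<alpha> j) (rate_split N \<rho>) s \<and>
                W \<rho> = (\<Prod>j=1..N. U j (s j) powr \<alpha> j))"

definition strictly_concave_on :: "real set \<Rightarrow> (real \<Rightarrow> real) \<Rightarrow> bool" where
  "strictly_concave_on S f \<longleftrightarrow> convex S \<and>
     (\<forall>x\<in>S. \<forall>y\<in>S. \<forall>t. x \<noteq> y \<longrightarrow> 0 < t \<longrightarrow> t < 1 \<longrightarrow>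
        (1 - t) * f x + t * f y < f ((1 - t) * x + t * y))"

definition standing_facts :: "(real \<Rightarrow> real) \<Rightarrow> bool" where
  "standing_facts W \<longleftrightarrow> W 0 = 0 \<and> (\<forall>\<rho>>0. 0 < W \<rho>) \<and>
     (\<forall>\<rho>>0. (\<lambda>x. ln (W x)) differentiable (at \<rho>)) \<and>
     strictly_concave_on {0<..} (\<lambda>x. ln (W x))"

definition slope_curvature :: "real \<Rightarrow> (real \<Rightarrow> real) \<Rightarrow> real \<Rightarrow> real" where
  "slope_curvature b W \<rho> = b * deriv (\<lambda>x. ln (W x)) \<rho>"

definition feasible_rates :: "nat \<Rightarrow> real \<Rightarrow> (nat \<Rightarrow> real) \<Rightarrow> bool" where
  "feasible_rates M R r \<longleftrightarrow> (\<forall>i\<in>{1..M}. 0 \<le> r i) \<and> (\<Sum>i=1..M. r i) \<le> R"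

definition optimal_rates ::
  "nat \<Rightarrow> real \<Rightarrow> (nat \<Rightarrow> real) \<Rightarrow> (nat \<Rightarrow> real \<Rightarrow> real) \<Rightarrow> (nat \<Rightarrow> real) \<Rightarrow> bool" where
  "optimal_rates M R \<beta> W r \<longleftrightarrow>
     is_arg_max (\<lambda>r. \<Prod>i=1..M. W i (r i) powr \<beta> i) (feasible_rates M R) r"

definition lagrangian ::
  "nat \<Rightarrow> real \<Rightarrow> (nat \<Rightarrow> real) \<Rightarrow> (nat \<Rightarrow> real \<Rightarrow> real) \<Rightarrow> (nat \<Rightarrow> real) \<Rightarrow> real \<Rightarrow> real" where
  "lagrangian M R \<beta> W r p = (\<Sum>i=1..M. \<beta> i * ln (W i (r i))) - p * ((\<Sum>i=1..M. r i) - R)"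

text \<open>The first-order (Karush-Kuhn-Tucker) conditions for the multiplier \<open>p\<close> of the rate constraint
  at \<open>r\<close>. The logarithmic objective is only defined for positive rates (\<open>W i 0 = 0\<close>), so the
  constraints \<open>0 \<le> r i\<close> are inactive and carry no multiplier.\<close>

definition lagrange_multiplier ::
  "nat \<Rightarrow> real \<Rightarrow> (nat \<Rightarrow> real) \<Rightarrow> (nat \<Rightarrow> real \<Rightarrow> real) \<Rightarrow> (nat \<Rightarrow> real) \<Rightarrow> real \<Rightarrow> bool" where
  "lagrange_multiplier M R \<beta> W r p \<longleftrightarrow>
     (\<forall>i\<in>{1..M}. 0 < r i) \<and> (\<Sum>i=1..M. r i) \<le> R \<and>
     0 \<le> p \<and> p * ((\<Sum>i=1..M. r i) - R) = 0 \<and>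
     (\<forall>i\<in>{1..M}. ((\<lambda>x. lagrangian M R \<beta> W (r(i := x)) p) has_real_derivative 0) (at (r i)))"

text \<open>The optimal rates and their multiplier are unique under the standing facts; see
  \<open>optimal_rates_unique\<close> and \<open>lagrange_multiplier_unique\<close> below.\<close>

definition optimal_bids ::
  "nat \<Rightarrow> real \<Rightarrow> (nat \<Rightarrow> real) \<Rightarrow> (nat \<Rightarrow> real \<Rightarrow> real) \<Rightarrow> (nat \<Rightarrow> real) \<Rightarrow> bool" where
  "optimal_bids M R \<beta> W w \<longleftrightarrow>
     (\<exists>r p. optimal_rates M R \<beta> W r \<and> lagrange_multiplier M R \<beta> W r p \<and>
            (\<forall>i\<in>{1..M}. w i = p * r i))"

text \<open>Membership of the price in the image makes the inverse of the (injective) slope curvature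
  function meaningful, as \<open>inv_into\<close> is arbitrary outside the range.\<close>

definition steady_state ::
  "nat \<Rightarrow> real \<Rightarrow> (nat \<Rightarrow> real) \<Rightarrow> (nat \<Rightarrow> real \<Rightarrow> real) \<Rightarrow>
   real \<Rightarrow> (nat \<Rightarrow> real) \<Rightarrow> (nat \<Rightarrow> real) \<Rightarrow> bool" where
  "steady_state M R \<beta> W p r w \<longleftrightarrow>
     0 < p \<and> p = 1 / R * (\<Sum>i=1..M. w i) \<and>
     (\<forall>i\<in>{1..M}. w i = p * r i \<and>
        p \<in> slope_curvature (\<beta> i) (W i) ` {0<..} \<and>
        r i = inv_into {0<..} (slope_curvature (\<beta> i) (W i)) p)"

definition utilities_after_change ::
  "nat \<Rightarrow> (nat \<Rightarrow> real \<Rightarrow> real) \<Rightarrow> (nat \<Rightarrow> real \<Rightarrow> real) \<Rightarrow> nat \<Rightarrow> real \<Rightarrow> real" where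
  "utilities_after_change M' V V' i = (if i \<le> M' then V' i else V i)"

lemma optimal_rates_pos:
  fixes M :: nat and R :: real
  assumes R: "0 < R"
    and W: "\<And>i. i \<in> {1..M} \<Longrightarrow> standing_facts (W i)"
    and opt: "optimal_rates M R \<beta> W r" and i: "i \<in> {1..M}"
  shows "0 < r i"
proof (rule ccontr)
  assume "\<not> 0 < r i"
  moreover have "0 \<le> r i"
    using opt i by (auto simp: optimal_rates_def is_arg_max_def feasible_rates_def)
  ultimately have "W i (r i) = 0"
    using W[OF i] by (simp add: standing_facts_def)
  then have zero: "(\<Prod>i=1..M. W i (r i) powr \<beta> i) = 0"
    using i by (intro prod_zero) auto
  have feas: "feasible_rates M R (\<lambda>_. R / real M)"
    using R i by (auto simp: feasible_rates_def)
  have "0 < (\<Prod>i=1..M. W i (R / real M) powr \<beta> i)"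
  proof (rule prod_pos)
    fix k assume k: "k \<in> {1..M}"
    then have "0 < R / real M"
      using R by auto
    then have "0 < W k (R / real M)"
      using W[OF k] unfolding standing_facts_def by blast
    then show "0 < W k (R / real M) powr \<beta> k"
      by simp
  qed
  moreover have "(\<Prod>i=1..M. W i (R / real M) powr \<beta> i) \<le> (\<Prod>i=1..M. W i (r i) powr \<beta> i)"
    using opt feas unfolding optimal_rates_def is_arg_max_linorder by blast
  ultimately show False
    unfolding zero by simp
qed

lemma optimal_rates_unique:
  fixes M :: nat and R :: real
  assumes R: "0 < R" and \<beta>: "\<And>i. i \<in> {1..M} \<Longrightarrow> 0 < \<beta> i"
    and W: "\<And>i. i \<in> {1..M} \<Longrightarrow> standing_facts (W i)"
    and r: "optimal_rates M R \<beta> W r" and s: "optimal_rates M R \<beta> W s"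
    and i: "i \<in> {1..M}"
  shows "r i = s i"
proof (rule ccontr)
  assume ne: "r i \<noteq> s i"
  define m where "m k = (r k + s k) / 2" for k
  have pos: "0 < r k" "0 < s k" "0 < m k" if "k \<in> {1..M}" for k
    using optimal_rates_pos[OF R W r that] optimal_rates_pos[OF R W s that]
    by (auto simp: m_def)
  have Wpos: "0 < W k x" if "k \<in> {1..M}" "0 < x" for k x
    using W[OF that(1)] that(2) unfolding standing_facts_def by blast
  define F where "F r = (\<Prod>k=1..M. W k (r k) powr \<beta> k)" for r
  have lnF: "ln (F t) = (\<Sum>k=1..M. \<beta> k * ln (W k (t k)))" and Fpos: "0 < F t"
    if t: "\<And>k. k \<in> {1..M} \<Longrightarrow> 0 < t k" for t
  proof -
    have P: "0 < W k (t k) powr \<beta> k" if "k \<in> {1..M}" for k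
      using Wpos[OF that t[OF that]] by simp
    then show "0 < F t"
      unfolding F_def by (intro prod_pos) auto
    have "ln (F t) = (\<Sum>k=1..M. ln (W k (t k) powr \<beta> k))"
      unfolding F_def using P by (subst ln_prod) auto
    also have "\<dots> = (\<Sum>k=1..M. \<beta> k * ln (W k (t k)))"
      by (intro sum.cong refl ln_powr)
    finally show "ln (F t) = (\<Sum>k=1..M. \<beta> k * ln (W k (t k)))" .
  qed
  have feas: "feasible_rates M R r" "feasible_rates M R s"
    using r s by (auto simp: optimal_rates_def is_arg_max_def)
  have "(\<Sum>k=1..M. m k) = ((\<Sum>k=1..M. r k) + (\<Sum>k=1..M. s k)) / 2"
    by (simp add: m_def sum.distrib flip: sum_divide_distrib)
  then have feas_m: "feasible_rates M R m"
    using feas by (auto simp: feasible_rates_def m_def)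
  have FF: "F r = F s" "F m \<le> F r"
    using r s feas feas_m unfolding optimal_rates_def is_arg_max_linorder F_def
    by (blast intro: order.antisym)+
  have mid: "ln (W k (r k)) + ln (W k (s k)) < 2 * ln (W k (m k))"
    if k: "k \<in> {1..M}" and "r k \<noteq> s k" for k
  proof -
    have "\<forall>x\<in>{0<..}. \<forall>y\<in>{0<..}. \<forall>t. x \<noteq> y \<longrightarrow> 0 < t \<longrightarrow> t < 1 \<longrightarrow>
            (1 - t) * ln (W k x) + t * ln (W k y) < ln (W k ((1 - t) * x + t * y))"
      using W[OF k] by (simp add: standing_facts_def strictly_concave_on_def)
    from this[rule_format, of "r k" "s k" "1/2"] pos[OF k] \<open>r k \<noteq> s k\<close>
    have "ln (W k (r k)) / 2 + ln (W k (s k)) / 2 < ln (W k (r k / 2 + s k / 2))"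
      by simp
    moreover have "r k / 2 + s k / 2 = m k"
      by (simp add: m_def field_simps)
    ultimately show ?thesis
      by simp
  qed
  have "(\<Sum>k=1..M. \<beta> k * (ln (W k (r k)) + ln (W k (s k)))) <
        (\<Sum>k=1..M. \<beta> k * (2 * ln (W k (m k))))"
  proof (rule sum_strict_mono_ex1)
    show "\<forall>k\<in>{1..M}. \<beta> k * (ln (W k (r k)) + ln (W k (s k))) \<le> \<beta> k * (2 * ln (W k (m k)))"
    proof
      fix k assume k: "k \<in> {1..M}"
      have "ln (W k (r k)) + ln (W k (s k)) \<le> 2 * ln (W k (m k))"
        using mid[OF k] by (cases "r k = s k") (auto simp: m_def)
      then show "\<beta> k * (ln (W k (r k)) + ln (W k (s k))) \<le> \<beta> k * (2 * ln (W k (m k)))"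
        using \<beta>[OF k] by (intro mult_left_mono) auto
    qed
    show "\<exists>k\<in>{1..M}. \<beta> k * (ln (W k (r k)) + ln (W k (s k))) < \<beta> k * (2 * ln (W k (m k)))"
      using mid[OF i ne] \<beta>[OF i] i by (intro bexI[of _ i] mult_strict_left_mono) auto
  qed simp
  then have "ln (F r) + ln (F s) < 2 * ln (F m)"
    using lnF[of r] lnF[of s] lnF[of m] pos
    by (simp add: sum.distrib distrib_left sum_distrib_left mult.left_commute)
  moreover have "ln (F m) \<le> ln (F r)"
    using FF(2) Fpos pos by simp
  ultimately show False
    using FF(1) by simp
qed

lemma lagrange_multiplier_unique:
  fixes M :: nat and R :: real
  assumes M: "0 < M"
    and p: "lagrange_multiplier M R \<beta> W r p" and q: "lagrange_multiplier M R \<beta> W r q"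
  shows "p = q"
proof -
  have 1: "1 \<in> {1..M}"
    using M by simp
  have "((\<lambda>x. lagrangian M R \<beta> W (r(1 := x)) p - lagrangian M R \<beta> W (r(1 := x)) q)
          has_real_derivative 0 - 0) (at (r 1))"
    using p q 1 unfolding lagrange_multiplier_def by (intro DERIV_diff) blast+
  moreover have "(\<lambda>x. lagrangian M R \<beta> W (r(1 := x)) p - lagrangian M R \<beta> W (r(1 := x)) q) =
                 (\<lambda>x. (q - p) * (x + ((\<Sum>i\<in>{1..M} - {1}. r i) - R)))"
  proof
    fix x
    have "(\<Sum>i=1..M. (r(1 := x)) i) = x + (\<Sum>i\<in>{1..M} - {1}. r i)"
      by (subst sum.remove[OF _ 1]) (auto intro!: sum.cong)
    then show "lagrangian M R \<beta> W (r(1 := x)) p - lagrangian M R \<beta> W (r(1 := x)) q =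
               (q - p) * (x + ((\<Sum>i\<in>{1..M} - {1}. r i) - R))"
      unfolding lagrangian_def by (simp only:) (simp add: algebra_simps)
  qed
  ultimately have "((\<lambda>x. (q - p) * (x + ((\<Sum>i\<in>{1..M} - {1}. r i) - R)))
                     has_real_derivative 0) (at (r 1))"
    by simp
  moreover have "((\<lambda>x. (q - p) * (x + ((\<Sum>i\<in>{1..M} - {1}. r i) - R)))
                   has_real_derivative q - p) (at (r 1))"
    by (auto intro!: derivative_eq_intros)
  ultimately show ?thesis
    using DERIV_unique by fastforce
qed

end

theory Submission
  imports Defs
begin

text \<open>At a steady state every rate satisfies \<open>\<beta> i * (ln \<circ> W i)' (r i) = p\<close>, and summing the bids
  \<open>p * r i\<close> to \<open>p * R\<close> shows that the rate constraint is tight. These are the Karush-Kuhn-Tucker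
  conditions, and they suffice because the weighted logarithmic utilities lie below their tangents,
  all of slope \<open>p\<close>, at the steady-state rates.\<close>

text \<open>\<open>slope_curvature\<close> is built from \<open>deriv\<close>, which picks a
  derivative by choice; differentiability of \<open>ln (W x)\<close> makes the picked value the
  actual derivative.\<close>

lemma standing_facts_has_slope:
  assumes W: "standing_facts W" and a: "0 < a"
  shows "((\<lambda>x. b * ln (W x)) has_real_derivative slope_curvature b W a) (at a)"
proof -
  have "(\<lambda>x. ln (W x)) field_differentiable (at a)"
    using W a unfolding standing_facts_def real_differentiable_def field_differentiable_def by blast
  then show ?thesis
    unfolding slope_curvature_def by (intro DERIV_cmult field_differentiable_derivI)
qed

text \<open>A differentiable concave function lies below its tangents. The weight \<open>b\<close>
  is nonnegative, so negating \<open>b * ln (W x)\<close> gives a convex function, which lies above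
  its tangents.\<close>

lemma standing_facts_le_tangent:
  assumes W: "standing_facts W" and b: "0 \<le> b" and a: "0 < a" and x: "0 < x"
  shows "b * ln (W x) \<le> b * ln (W a) + slope_curvature b W a * (x - a)"
proof -
  have conc: "convex_on {0<..} (\<lambda>x. - (b * ln (W x)))"
  proof (rule convex_onI)
    fix t x y :: real
    assume t: "0 < t" "t < 1" and xy: "x \<in> {0<..}" "y \<in> {0<..}"
    have "(1 - t) * ln (W x) + t * ln (W y) \<le> ln (W ((1 - t) * x + t * y))"
    \<comment> \<open>Strict concavity speaks only of distinct points; for equal ones both sides
      coincide.\<close>
    proof (cases "x = y")
      case True
      then show ?thesis
        by (simp add: algebra_simps)
    next
      case False
      then show ?thesis
        using W t xy unfolding standing_facts_def strictly_concave_on_def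
        by (blast intro: less_imp_le)
    qed
    from mult_left_mono[OF this b]
    show "- (b * ln (W ((1 - t) *\<^sub>R x + t *\<^sub>R y))) \<le>
          (1 - t) * - (b * ln (W x)) + t * - (b * ln (W y))"
      by (simp add: algebra_simps)
  qed simp
  have "((\<lambda>x. - (b * ln (W x))) has_real_derivative - slope_curvature b W a) (at a within {0<..})"
    by (intro DERIV_minus DERIV_subset[OF standing_facts_has_slope[OF W a]]) simp
  moreover have "a \<in> interior {0<..}"
    using a by (simp add: interior_open)
  ultimately have "- (b * ln (W x)) - - (b * ln (W a)) \<ge> - slope_curvature b W a * (x - a)"
    using x by (intro convex_on_imp_above_tangent[OF conc]) auto
  then show ?thesis
    by simp
qed

text \<open>Moving only coordinate \<open>i\<close>, the utility term has slope \<open>p\<close> and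
  the price term slope \<open>-p\<close>, so they cancel. Complementary slackness holds because the
  rates exhaust \<open>R\<close>.\<close>

lemma lagrange_multiplierI:
  assumes W: "\<And>i. i \<in> {1..M} \<Longrightarrow> standing_facts (W i)"
    and pos: "\<And>i. i \<in> {1..M} \<Longrightarrow> 0 < r i" and sum: "(\<Sum>i=1..M. r i) = R" and p: "0 \<le> p"
    and slope: "\<And>i. i \<in> {1..M} \<Longrightarrow> slope_curvature (\<beta> i) (W i) (r i) = p"
  shows "lagrange_multiplier M R \<beta> W r p"
proof -
  have "((\<lambda>x. lagrangian M R \<beta> W (r(i := x)) p) has_real_derivative 0) (at (r i))"
    if i: "i \<in> {1..M}" for i
  proof -
    have utility: "((\<lambda>x. \<beta> k * ln (W k ((r(i := x)) k))) has_real_derivative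
                    (if k = i then p else 0)) (at (r i))" for k
    proof (cases "k = i")
      case True
      then show ?thesis
        using standing_facts_has_slope[OF W[OF i] pos[OF i], of "\<beta> i"] slope[OF i] by simp
    qed simp
    have rate: "((\<lambda>x. (r(i := x)) k) has_real_derivative (if k = i then 1 else 0)) (at (r i))"
      for k
      by (cases "k = i") auto
    have "((\<lambda>x. lagrangian M R \<beta> W (r(i := x)) p) has_real_derivative
            (\<Sum>k=1..M. if k = i then p else 0) - p * ((\<Sum>k=1..M. if k = i then 1 else 0) - 0))
          (at (r i))"
      unfolding lagrangian_def
      by (intro DERIV_diff DERIV_cmult DERIV_sum DERIV_const utility rate)
    then show ?thesis
      using i by simp
  qed
  then show ?thesis
    unfolding lagrange_multiplier_def using pos sum p by simp
qed

text \<open>The tangent bounds exist only at positive rates, so competitors with a vanishing rate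
  are treated separately.\<close>

lemma optimal_ratesI:
  assumes W: "\<And>i. i \<in> {1..M} \<Longrightarrow> standing_facts (W i)"
    and \<beta>: "\<And>i. i \<in> {1..M} \<Longrightarrow> 0 < \<beta> i"
    and pos: "\<And>i. i \<in> {1..M} \<Longrightarrow> 0 < r i" and sum: "(\<Sum>i=1..M. r i) = R" and p: "0 \<le> p"
    and slope: "\<And>i. i \<in> {1..M} \<Longrightarrow> slope_curvature (\<beta> i) (W i) (r i) = p"
  shows "optimal_rates M R \<beta> W r"
proof -
  have prod_eq: "(\<Prod>i=1..M. W i (t i) powr \<beta> i) = exp (\<Sum>i=1..M. \<beta> i * ln (W i (t i)))"
    if "\<And>i. i \<in> {1..M} \<Longrightarrow> 0 < t i" for t
  proof -
    have "W i (t i) \<noteq> 0" if "i \<in> {1..M}" for i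
      using W[OF that] \<open>\<And>i. i \<in> {1..M} \<Longrightarrow> 0 < t i\<close>[OF that]
      unfolding standing_facts_def by (metis less_irrefl)
    then show ?thesis
      by (simp add: exp_sum powr_def)
  qed
  have "(\<Prod>i=1..M. W i (s i) powr \<beta> i) \<le> (\<Prod>i=1..M. W i (r i) powr \<beta> i)"
    if s: "feasible_rates M R s" for s
  proof (cases "\<forall>i\<in>{1..M}. 0 < s i")
    case True
    have "(\<Sum>i=1..M. \<beta> i * ln (W i (s i))) \<le>
          (\<Sum>i=1..M. \<beta> i * ln (W i (r i)) + p * (s i - r i))"
    proof (rule sum_mono)
      fix i assume i: "i \<in> {1..M}"
      show "\<beta> i * ln (W i (s i)) \<le> \<beta> i * ln (W i (r i)) + p * (s i - r i)"
        using standing_facts_le_tangent[OF W[OF i] less_imp_le[OF \<beta>[OF i]] pos[OF i]]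
          True i slope[OF i] by auto
    qed
    \<comment> \<open>Since \<open>r\<close> sums to exactly \<open>R\<close>, the linear terms add
      up to the price of the excess of \<open>s\<close> over \<open>R\<close>, which is not positive
      for feasible \<open>s\<close>.\<close>
    also have "\<dots> = (\<Sum>i=1..M. \<beta> i * ln (W i (r i))) + p * ((\<Sum>i=1..M. s i) - R)"
      unfolding sum.distrib sum_distrib_left[symmetric] sum_subtractf sum ..
    also have "\<dots> \<le> (\<Sum>i=1..M. \<beta> i * ln (W i (r i)))"
      using s p by (simp add: feasible_rates_def mult_nonneg_nonpos)
    finally show ?thesis
      using True pos by (subst (1 2) prod_eq) auto
  next
    case False
    then obtain i where i: "i \<in> {1..M}" "s i = 0"
      using s unfolding feasible_rates_def by force
    \<comment> \<open>Here \<open>W i 0 = 0\<close> and \<open>0 powr \<beta> i = 0\<close>, so one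
      idle UE makes the whole product vanish, while the product at \<open>r\<close> is
      nonnegative.\<close>
    then have zero: "(\<Prod>i=1..M. W i (s i) powr \<beta> i) = 0"
      using W[OF i(1)] by (intro prod_zero) (auto simp: standing_facts_def intro!: bexI[of _ i])
    show ?thesis
      unfolding zero by (simp add: prod_nonneg)
  qed
  moreover have "feasible_rates M R r"
    using pos sum by (auto simp: feasible_rates_def intro: less_imp_le)
  ultimately show ?thesis
    unfolding optimal_rates_def is_arg_max_linorder by blast
qed

text \<open>The steady-state price itself serves as the multiplier. The family \<open>W\<close> is
  arbitrary, so one argument covers the times before and after the change.\<close>

lemma steady_state_optimal:
  assumes R: "0 < R"
    and \<beta>: "\<And>i. i \<in> {1..M} \<Longrightarrow> 0 < \<beta> i"
    and W: "\<And>i. i \<in> {1..M} \<Longrightarrow> standing_facts (W i)"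
    and steady: "steady_state M R \<beta> W p r w"
  shows "optimal_rates M R \<beta> W r" and "optimal_bids M R \<beta> W w"
proof -
  have p: "0 < p" and price: "p = 1 / R * (\<Sum>i=1..M. w i)"
    and bid: "\<And>i. i \<in> {1..M} \<Longrightarrow> w i = p * r i"
    using steady unfolding steady_state_def by blast+
  have pos: "0 < r i" and slope: "slope_curvature (\<beta> i) (W i) (r i) = p"
    if "i \<in> {1..M}" for i
  proof -
    have range: "p \<in> slope_curvature (\<beta> i) (W i) ` {0<..}"
      and ri: "r i = inv_into {0<..} (slope_curvature (\<beta> i) (W i)) p"
      using steady that unfolding steady_state_def by blast+
    \<comment> \<open>As \<open>p\<close> lies in the image of \<open>{0<..}\<close>, its chosen
      preimage is positive and is mapped back to \<open>p\<close>.\<close>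
    show "0 < r i"
      using inv_into_into[OF range] ri by simp
    show "slope_curvature (\<beta> i) (W i) (r i) = p"
      using f_inv_into_f[OF range] ri by simp
  qed
  \<comment> \<open>The total of the bids is computed once from the bids and once from the price
    update; cancelling \<open>p > 0\<close> shows that the constraint is tight.\<close>
  have "p * (\<Sum>i=1..M. r i) = (\<Sum>i=1..M. w i)"
    using bid by (simp add: sum_distrib_left)
  also have "\<dots> = p * R"
    using price R by (simp add: field_simps)
  finally have sum: "(\<Sum>i=1..M. r i) = R"
    using p by simp
  show opt: "optimal_rates M R \<beta> W r"
    by (rule optimal_ratesI[OF W \<beta> pos sum less_imp_le[OF p] slope])
  have "lagrange_multiplier M R \<beta> W r p"
    by (rule lagrange_multiplierI[OF W pos sum less_imp_le[OF p] slope])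
  with opt bid show "optimal_bids M R \<beta> W w"
    unfolding optimal_bids_def by blast
qed

theorem mainTheorem7:
  fixes M M' n1 n2 :: nat
    and R :: real
    and \<beta> :: "nat \<Rightarrow> real"
    and N :: "nat \<Rightarrow> nat"
    and U :: "nat \<Rightarrow> nat \<Rightarrow> real \<Rightarrow> real"
    and \<alpha> \<alpha>' :: "nat \<Rightarrow> nat \<Rightarrow> real"
    and V V' :: "nat \<Rightarrow> real \<Rightarrow> real"
    and p :: "nat \<Rightarrow> real"
    and r w :: "nat \<Rightarrow> nat \<Rightarrow> real"
  assumes "R > 0" and "M' < M" and "n1 < n2"
    and "\<And>i. i \<in> {1..M} \<Longrightarrow> \<beta> i > 0"
    and "\<And>i j x. i \<in> {1..M} \<Longrightarrow> j \<in> {1..N i} \<Longrightarrow> x \<ge> 0 \<Longrightarrow> U i j x \<ge> 0"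
    and "\<And>i. i \<in> {1..M} \<Longrightarrow> usage_percentages (N i) (\<alpha> i)"
    and "\<And>i. i \<in> {1..M} \<Longrightarrow> aggregated_utility (N i) (U i) (\<alpha> i) (V i)"
    and "\<And>i. i \<in> {1..M} \<Longrightarrow> standing_facts (V i)"
    and "\<And>i. i \<in> {1..M'} \<Longrightarrow> usage_percentages (N i) (\<alpha>' i)"
    and "\<And>i. i \<in> {1..M'} \<Longrightarrow> aggregated_utility (N i) (U i) (\<alpha>' i) (V' i)"
    and "\<And>i. i \<in> {1..M'} \<Longrightarrow> standing_facts (V' i)"
    and "steady_state M R \<beta> V (p n1) (\<lambda>i. r i n1) (\<lambda>i. w i n1)"
    and "steady_state M R \<beta> (utilities_after_change M' V V') (p n2) (\<lambda>i. r i n2) (\<lambda>i. w i n2)"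
  shows "optimal_rates M R \<beta> V (\<lambda>i. r i n1) \<and> optimal_bids M R \<beta> V (\<lambda>i. w i n1) \<and>
         optimal_rates M R \<beta> (utilities_after_change M' V V') (\<lambda>i. r i n2) \<and>
         optimal_bids M R \<beta> (utilities_after_change M' V V') (\<lambda>i. w i n2)"
proof -
  \<comment> \<open>UEs up to \<open>M'\<close> inherit the facts from \<open>V'\<close>, the others
    from \<open>V\<close>.\<close>
  have "standing_facts (utilities_after_change M' V V' i)" if "i \<in> {1..M}" for i
    using that assms(8,11) by (simp add: utilities_after_change_def)
  then show ?thesis
    using steady_state_optimal[OF assms(1,4,8,12)] steady_state_optimal[OF assms(1,4) _ assms(13)]
    by blast
qed

end
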